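(* Let $n$ be a positive integer and let $a,b$ be indeterminates. Let $\mathcal{G}_n$ be the cycle with $n$ pendant edges, with nodes $\mathcal{N}(\mathcal{G}_n)=\{v_1',\dots,v_n'\}$ and weight $w(e_i')=a$, $w(e_i)=b$ for $i=1,\dots,n$. Let $F_n(a,b):=Z(\mathcal{G}_n)$ be the weighted sum of rooted spanning forests of $\mathcal{G}_n$. Then \[ F_n(a,b)=2b^n\left(T_n\left(\frac{a}{2b}+1\right)-1\right), \] where $T_n$ is the Chebyshev polynomial of the first kind.
   Context: The cycle with $n$ pendant edges $\mathcal{G}_n$ has vertex set $\{v_1,\dots,v_n\}\cup\{v_1',\dots,v_n'\}$ and edges $e_i=v_iv_{i+1}$ ($i=1,\dots,n$, indices mod $n$, so $e_n=v_nv_1$) forming the cycle $C_n$, together with the pendant edges $e_i'=v_iv_i'$ ($i=1,\dots,n$). The vertex set is split into nodes $\mathcal{N}(\mathcal{G}_n)=\{v_1',\dots,v_n'\}$ and internal vertices $\{v_1,\dots,v_n\}$. A rooted spanning forest of a graph $\mathcal{G}$ with node set $\mathcal{N}(\mathcal{G})\subseteq V(\mathcal{G})$ is a subgraph $\mathcal{G}'$ with $V(\mathcal{G}')=V(\mathcal{G})$, containing no cycles, such that each connected component of $\mathcal{G}'$ contains exactly one vertex of $\mathcal{N}(\mathcal{G})$. For a weight $w:E(\mathcal{G})\to R$, the weighted sum of rooted spanning forests is $Z(\mathcal{G})=\sum_{\mathcal{G}'}\prod_{e\in E(\mathcal{G}')}w(e)$, the sum over all rooted spanning forests $\mathcal{G}'$.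 The Chebyshev polynomial of the first kind $T_n(x)$ is the polynomial with $T_n(\cos\theta)=\cos(n\theta)$ for all real $\theta$. *)

theory Defs
  imports Complex_Main "HOL-Computational_Algebra.Computational_Algebra"
begin

text \<open>
  Undirected multigraphs: \<open>ends G e\<close> is the set of endpoints of the edge \<open>e\<close>, a singleton if
  \<open>e\<close> is a loop. Loops and parallel edges are needed because the cycle of length 1 is a
  loop and the cycle of length 2 is a pair of parallel edges.
\<close>

record ('v, 'e) mgraph =
  verts :: "'v set"
  edges :: "'e set"
  ends :: "'e \<Rightarrow> 'v set"

text \<open>
  A subgraph keeps the whole (total) incidence function of the ambient graph, so that it is
  determined by its vertices and edges.
\<close>

definition is_subgraph :: "('v, 'e) mgraph \<Rightarrow> ('v, 'e) mgraph \<Rightarrow> bool" where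
  "is_subgraph H G \<longleftrightarrow>
     verts H \<subseteq> verts G \<and> edges H \<subseteq> edges G \<and> ends H = ends G \<and>
     (\<forall>e\<in>edges H. ends H e \<subseteq> verts H)"

text \<open>
  A loop is a cycle of length 1, and two distinct parallel edges form a cycle of length 2.
\<close>

definition is_cycle :: "('v, 'e) mgraph \<Rightarrow> 'v list \<Rightarrow> 'e list \<Rightarrow> bool" where
  "is_cycle G vs es \<longleftrightarrow>
     vs \<noteq> [] \<and> length es = length vs \<and> distinct vs \<and> distinct es \<and>
     set vs \<subseteq> verts G \<and> set es \<subseteq> edges G \<and>
     (\<forall>i<length vs. ends G (es ! i) = {vs ! i, vs ! (Suc i mod length vs)})"

definition acyclic_graph :: "('v, 'e) mgraph \<Rightarrow> bool" where
  "acyclic_graph G \<longleftrightarrow> (\<nexists>vs es. is_cycle G vs es)"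

definition adjacent :: "('v, 'e) mgraph \<Rightarrow> ('v \<times> 'v) set" where
  "adjacent G = {(u, v). \<exists>e\<in>edges G. ends G e = {u, v}}"

definition components :: "('v, 'e) mgraph \<Rightarrow> 'v set set" where
  "components G = verts G // ((adjacent G)\<^sup>* \<inter> verts G \<times> verts G)"

definition rooted_spanning_forest ::
    "('v, 'e) mgraph \<Rightarrow> 'v set \<Rightarrow> ('v, 'e) mgraph \<Rightarrow> bool" where
  "rooted_spanning_forest G N H \<longleftrightarrow>
     is_subgraph H G \<and> verts H = verts G \<and> acyclic_graph H \<and>
     (\<forall>C\<in>components H. \<exists>!x. x \<in> C \<and> x \<in> N)"

definition forest_sum ::
    "('v, 'e) mgraph \<Rightarrow> 'v set \<Rightarrow> ('e \<Rightarrow> 'a::comm_ring_1) \<Rightarrow> 'a" where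
  "forest_sum G N w = (\<Sum>H | rooted_spanning_forest G N H. \<Prod>e\<in>edges H. w e)"

text \<open>
  \<open>Inner i\<close>, \<open>Leaf i\<close>, \<open>Cyc i\<close>, \<open>Pend i\<close> are the \<open>v\<^sub>i\<close>, \<open>v\<^sub>i'\<close>, \<open>e\<^sub>i\<close>, \<open>e\<^sub>i'\<close>, for \<open>i = 1, \<dots>, n\<close>.
\<close>

datatype vertex = Inner nat | Leaf nat

datatype edge = Cyc nat | Pend nat

text \<open>For \<open>1 \<le> i \<le> n\<close>, \<open>i mod n + 1\<close> is the cyclic successor of \<open>i\<close> in \<open>{1..n}\<close>.\<close>

fun pendant_cycle_ends :: "nat \<Rightarrow> edge \<Rightarrow> vertex set" where
  "pendant_cycle_ends n (Cyc i) = {Inner i, Inner (i mod n + 1)}"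
| "pendant_cycle_ends n (Pend i) = {Inner i, Leaf i}"

definition pendant_cycle :: "nat \<Rightarrow> (vertex, edge) mgraph" where
  "pendant_cycle n =
     \<lparr>verts = Inner ` {1..n} \<union> Leaf ` {1..n},
      edges = Cyc ` {1..n} \<union> Pend ` {1..n},
      ends = pendant_cycle_ends n\<rparr>"

definition pendant_cycle_nodes :: "nat \<Rightarrow> vertex set" where
  "pendant_cycle_nodes n = Leaf ` {1..n}"

fun pendant_cycle_weight :: "'a \<Rightarrow> 'a \<Rightarrow> edge \<Rightarrow> 'a" where
  "pendant_cycle_weight a b (Cyc i) = b"
| "pendant_cycle_weight a b (Pend i) = a"

definition F :: "nat \<Rightarrow> 'a \<Rightarrow> 'a \<Rightarrow> 'a::comm_ring_1" where
  "F n a b = forest_sum (pendant_cycle n) (pendant_cycle_nodes n) (pendant_cycle_weight a b)"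

text \<open>
  The indeterminates of the field of rational functions in two variables over (the fraction
  field of) \<open>'r\<close>, that is, of the fraction field of \<open>'r[b][a]\<close> represented as \<open>'r poly poly\<close>.
\<close>

definition indet_a :: "'r::idom poly poly fract" where
  "indet_a = to_fract [:0, 1:]"

definition indet_b :: "'r::idom poly poly fract" where
  "indet_b = to_fract [:[:0, 1:]:]"

text \<open>
  The Chebyshev polynomial is taken with integer coefficients, so that it can be
  evaluated in every commutative ring; \<open>chebyshev_T_ex1\<close> shows that this is justified.
\<close>

definition chebyshev_T :: "nat \<Rightarrow> int poly" where
  "chebyshev_T n =
     (THE p. \<forall>\<theta>::real. poly (map_poly of_int p) (cos \<theta>) = cos (real n * \<theta>))"

lemma map_poly_of_int_diff:
  "map_poly (of_int :: int \<Rightarrow> real) (p - q) = map_poly of_int p - map_poly of_int q"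
  by (rule poly_eqI) (simp add: coeff_map_poly)

lemma map_poly_of_int_mult:
  "map_poly (of_int :: int \<Rightarrow> real) (p * q) = map_poly of_int p * map_poly of_int q"
  by (rule poly_eqI) (simp add: coeff_map_poly coeff_mult)

lemma chebyshev_ex:
  "\<exists>p::int poly. \<forall>\<theta>::real. poly (map_poly of_int p) (cos \<theta>) = cos (real n * \<theta>)"
proof (induction n rule: less_induct)
  case (less n)
  consider "n = 0" | "n = 1" | m where "n = Suc (Suc m)"
    by (metis One_nat_def not0_implies_Suc)
  then show ?case
  proof cases
    case 1
    then show ?thesis by (intro exI[of _ 1]) simp
  next
    case 2
    then show ?thesis by (intro exI[of _ "[:0, 1:]"]) (simp add: map_poly_pCons)
  next
    case (3 m)
    obtain p q :: "int poly"
      where p: "\<And>\<theta>::real. poly (map_poly of_int p) (cos \<theta>) = cos (real m * \<theta>)"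
        and q: "\<And>\<theta>::real. poly (map_poly of_int q) (cos \<theta>) = cos (real (Suc m) * \<theta>)"
      using less.IH[of m] less.IH[of "Suc m"] 3 by auto
    have "poly (map_poly of_int ([:0, 2:] * q - p)) (cos \<theta>) = cos (real n * \<theta>)" for \<theta> :: real
    proof -
      have "cos (real n * \<theta>) + cos (real m * \<theta>) = 2 * cos \<theta> * cos (real (Suc m) * \<theta>)"
        using cos_add[of "real (Suc m) * \<theta>" \<theta>] cos_diff[of "real (Suc m) * \<theta>" \<theta>] 3
        by (simp add: algebra_simps)
      then show ?thesis
        by (simp only: map_poly_of_int_diff map_poly_of_int_mult poly_diff poly_mult p q)
           (simp add: map_poly_pCons algebra_simps)
    qed
    then show ?thesis by blast
  qed
qed

lemma chebyshev_T_ex1: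
  "\<exists>!p::int poly. \<forall>\<theta>::real. poly (map_poly of_int p) (cos \<theta>) = cos (real n * \<theta>)"
proof (rule ex_ex1I[OF chebyshev_ex])
  fix p q :: "int poly"
  assume p: "\<forall>\<theta>::real. poly (map_poly of_int p) (cos \<theta>) = cos (real n * \<theta>)"
    and q: "\<forall>\<theta>::real. poly (map_poly of_int q) (cos \<theta>) = cos (real n * \<theta>)"
  let ?r = "map_poly of_int p - map_poly of_int q :: real poly"
  have "{-1..1} \<subseteq> {x::real. poly ?r x = 0}"
  proof
    fix x :: real
    assume "x \<in> {-1..1}"
    then have "cos (arccos x) = x" by simp
    then show "x \<in> {x. poly ?r x = 0}"
      using p[rule_format, of "arccos x"] q[rule_format, of "arccos x"] by simp
  qed
  then have "infinite {x::real. poly ?r x = 0}"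
    using infinite_Icc[of "-1::real" 1] by (meson finite_subset neg_less_0_iff_less order_less_trans zero_less_one)
  then have "?r = 0" using poly_roots_finite by blast
  then have "coeff (map_poly (of_int :: int \<Rightarrow> real) p) i = coeff (map_poly of_int q) i" for i
    by simp
  then show "p = q" by (intro poly_eqI) (simp add: coeff_map_poly)
qed

lemma chebyshev_T_cos:
  "poly (map_poly of_int (chebyshev_T n)) (cos \<theta>) = cos (real n * \<theta>)" for \<theta> :: real
  using theI'[OF chebyshev_T_ex1[of n]] unfolding chebyshev_T_def by blast

end

theory Submission
  imports Defs
begin

text \<open>
  In a rooted spanning forest, sending each non-root vertex to the first edge of its path to the
  root identifies the forest with a choice of one incident edge per non-root vertex along which
  some rank decreases. In the cycle with pendant edges, such a choice is a cyclic word in three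
  letters (leave by the pendant edge, forward, or backward) in which ``forward'' is never followed
  by ``backward'' and which is neither constantly ``forward'' nor constantly ``backward''. Hence
  the forest sum is the trace of the \<open>n\<close>-th power of a \<open>3 \<times> 3\<close> transfer matrix minus \<open>2 b\<^sup>n\<close>. The
  nonzero eigenvalues of this matrix have sum \<open>a + 2 b\<close> and product \<open>b\<^sup>2\<close>, so the trace satisfies the
  recurrence of \<open>2 b\<^sup>n T\<^sub>n (a / (2 b) + 1)\<close>.
\<close>

subsection \<open>Rooted spanning forests and parent functions\<close>

text \<open>The rank \<open>r\<close> certifies that following parent edges ends at a node, and it
  keeps loops from being parent edges. The functions are extensional, so distinct ones differ at
  some non-node.\<close>

definition parent_function ::
    "('v, 'e) mgraph \<Rightarrow> 'v set \<Rightarrow> ('v \<Rightarrow> 'e) \<Rightarrow> bool" where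
  "parent_function G N p \<longleftrightarrow>
     p \<in> (verts G - N) \<rightarrow>\<^sub>E edges G \<and>
     (\<exists>r :: 'v \<Rightarrow> nat. \<forall>v\<in>verts G - N. \<exists>u\<in>verts G. ends G (p v) = {v, u} \<and> r u < r v)"

definition parent_forest ::
    "('v, 'e) mgraph \<Rightarrow> 'v set \<Rightarrow> ('v \<Rightarrow> 'e) \<Rightarrow> ('v, 'e) mgraph" where
  "parent_forest G N p = \<lparr>verts = verts G, edges = p ` (verts G - N), ends = ends G\<rparr>"

lemma parent_forest_simps [simp]:
  "verts (parent_forest G N p) = verts G"
  "edges (parent_forest G N p) = p ` (verts G - N)"
  "ends (parent_forest G N p) = ends G"
  by (simp_all add: parent_forest_def)

lemma parent_functionE:
  assumes "parent_function G N p"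
  obtains r :: "'v \<Rightarrow> nat" and nxt :: "'v \<Rightarrow> 'v"
  where "\<And>v. v \<in> verts G - N \<Longrightarrow>
    p v \<in> edges G \<and> nxt v \<in> verts G \<and> ends G (p v) = {v, nxt v} \<and> r (nxt v) < r v"
proof -
  from assms obtain r :: "'v \<Rightarrow> nat"
    where "\<forall>v\<in>verts G - N. \<exists>u. u \<in> verts G \<and> ends G (p v) = {v, u} \<and> r u < r v"
    unfolding parent_function_def by blast
  then obtain nxt where "\<forall>v\<in>verts G - N. nxt v \<in> verts G \<and> ends G (p v) = {v, nxt v} \<and> r (nxt v) < r v"
    by (auto dest!: bchoice)
  moreover have "p v \<in> edges G" if "v \<in> verts G - N" for v
    using assms that unfolding parent_function_def by blast
  ultimately show ?thesis using that by blast
qed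

text \<open>Two vertices with a common parent edge would each be the next vertex of the other, so
  each would have the smaller rank. This lets products over forest edges become products over
  non-nodes.\<close>

lemma parent_function_inj_on:
  assumes "parent_function G N p"
  shows "inj_on p (verts G - N)"
proof -
  obtain r :: "'a \<Rightarrow> nat" and nxt where *: "\<And>v. v \<in> verts G - N \<Longrightarrow>
    p v \<in> edges G \<and> nxt v \<in> verts G \<and> ends G (p v) = {v, nxt v} \<and> r (nxt v) < r v"
    by (rule parent_functionE[OF assms]) blast
  show ?thesis
  proof (rule inj_onI, rule ccontr)
    fix v w
    assume vw: "v \<in> verts G - N" "w \<in> verts G - N" "p v = p w" "v \<noteq> w"
    then have "{v, nxt v} = {w, nxt w}" using * by metis
    then have "nxt v = w" "nxt w = v" using vw by (auto simp: doubleton_eq_iff)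
    then show False using *[OF vw(1)] *[OF vw(2)] by simp
  qed
qed

text \<open>On a cycle, both edges at a vertex of largest rank would have to be its parent edge.\<close>

lemma parent_forest_acyclic:
  assumes "parent_function G N p"
  shows "acyclic_graph (parent_forest G N p)"
  unfolding acyclic_graph_def
proof clarify
  fix vs es
  assume cyc: "is_cycle (parent_forest G N p) vs es"
  obtain r :: "'a \<Rightarrow> nat" and nxt where *: "\<And>v. v \<in> verts G - N \<Longrightarrow>
    p v \<in> edges G \<and> nxt v \<in> verts G \<and> ends G (p v) = {v, nxt v} \<and> r (nxt v) < r v"
    by (rule parent_functionE[OF assms]) blast
  let ?n = "length vs"
  have n: "?n > 0" and len: "length es = ?n" and de: "distinct es"
    and es: "set es \<subseteq> p ` (verts G - N)"
    and ends: "\<And>i. i < ?n \<Longrightarrow> ends G (es ! i) = {vs ! i, vs ! (Suc i mod ?n)}"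
    using cyc unfolding is_cycle_def by auto
  have "Max (r ` set vs) \<in> r ` set vs" using n by (intro Max_in) auto
  then obtain m where m: "m \<in> set vs" "Max (r ` set vs) = r m" by auto
  have max: "r v \<le> r m" if "v \<in> set vs" for v
    using that m(2)[symmetric] by simp
  obtain i where i: "i < ?n" "vs ! i = m" using m(1) by (metis in_set_conv_nth)
  have par: "es ! k = p m \<and> nxt m \<noteq> m"
    if k: "k < ?n" and at: "vs ! k = m \<or> vs ! (Suc k mod ?n) = m" for k
  proof -
    have "es ! k \<in> set es" using k len by simp
    then obtain v where v: "v \<in> verts G - N" "es ! k = p v" using es by blast
    have eq: "{v, nxt v} = {vs ! k, vs ! (Suc k mod ?n)}" using *[OF v(1)] ends[OF k] v(2) by simp
    have "Suc k mod ?n < ?n" using n by simp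
    then have "vs ! k \<in> set vs" "vs ! (Suc k mod ?n) \<in> set vs" using k by simp_all
    then have "{v, nxt v} \<subseteq> set vs" unfolding eq by simp
    then have "v \<in> set vs" "nxt v \<in> set vs" by simp_all
    then have "r v \<le> r m" using max by blast
    moreover have "m = v \<or> m = nxt v" using eq at by blast
    ultimately have "m = v" using *[OF v(1)] by auto
    then show ?thesis using v *[OF v(1)] by auto
  qed
  define j where "j = (if i = 0 then ?n - 1 else i - 1)"
  have j: "j < ?n" "Suc j mod ?n = i" using i n unfolding j_def by auto
  have "es ! i = es ! j" using par[OF i(1)] par[OF j(1)] i(2) j(2) by simp
  \<comment> \<open>The cycle can then only be a loop at \<open>m\<close>, which the strict drop of
    rank along a parent edge forbids.\<close>
  then have "i = j" using de i(1) j(1) len by (simp add: nth_eq_iff_index_eq)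
  then have "{m} = ends G (p m)" using ends[OF i(1)] par[OF i(1)] i(2) j(2) by simp
  moreover have "p m \<in> p ` (verts G - N)" using par[OF i(1)] i es len by (metis nth_mem subsetD)
  then obtain v where "v \<in> verts G - N" "p m = p v" by blast
  ultimately show False using * by (metis doubleton_eq_iff insert_absorb2 less_irrefl_nat)
qed

section \<open>Components of a parent forest and their roots\<close>

lemma adjacent_sym: "(u, v) \<in> adjacent H \<Longrightarrow> (v, u) \<in> adjacent H"
  unfolding adjacent_def by (auto simp: insert_commute)

lemma adjacent_rtrancl_sym: "(u, v) \<in> (adjacent H)\<^sup>* \<Longrightarrow> (v, u) \<in> (adjacent H)\<^sup>*"
  by (meson adjacent_sym symI sym_rtrancl symD)

lemma components_eq:
  "components H = (\<lambda>x. {y \<in> verts H. (x, y) \<in> (adjacent H)\<^sup>*}) ` verts H"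
  unfolding components_def quotient_def by (auto simp: Image_def)

text \<open>The end of the walk along parent edges is the same for both ends of a forest edge, hence
  constant on components, and a node is its own end.\<close>

lemma parent_forest_unique_root:
  assumes "parent_function G N p" and "C \<in> components (parent_forest G N p)"
  shows "\<exists>!x. x \<in> C \<and> x \<in> N"
proof -
  let ?V = "verts G" and ?A = "adjacent (parent_forest G N p)"
  obtain r :: "'a \<Rightarrow> nat" and nxt where *: "\<And>v. v \<in> verts G - N \<Longrightarrow>
    p v \<in> edges G \<and> nxt v \<in> verts G \<and> ends G (p v) = {v, nxt v} \<and> r (nxt v) < r v"
    by (rule parent_functionE[OF assms(1)]) blast
  \<comment> \<open>Nodes are fixed points of \<open>g\<close>, so \<open>r v\<close> iterations
    from \<open>v\<close> reach a node and further ones change nothing.\<close>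
  define g where "g v = (if v \<in> N then v else nxt v)" for v
  define root where "root v = (g ^^ r v) v" for v
  have g_nxt: "g v = nxt v" if "v \<notin> N" for v using that by (simp add: g_def)
  have fixed: "(g ^^ k) x = x" if "x \<in> N" for x k
    by (induction k) (use that in \<open>auto simp: g_def\<close>)
  have reach: "(g ^^ k) v \<in> N \<inter> ?V" if "v \<in> ?V" "r v \<le> k" for v k
    using that
  proof (induction k arbitrary: v)
    case 0
    then show ?case using *[of v] by (cases "v \<in> N") auto
  next
    case (Suc k)
    show ?case
    proof (cases "v \<in> N")
      case True
      then show ?thesis using fixed[OF True, of "Suc k"] Suc.prems by (simp del: funpow.simps)
    next
      case False
      then have "(g ^^ k) (nxt v) \<in> N \<inter> ?V" using *[of v] Suc.prems by (intro Suc.IH) auto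
      then show ?thesis using False by (simp add: funpow_Suc_right g_nxt del: funpow.simps)
    qed
  qed
  have stable: "(g ^^ k) v = root v" if "v \<in> ?V" "r v \<le> k" for v k
  proof -
    have "(g ^^ k) v = (g ^^ (k - r v)) (root v)"
      using that(2) funpow_add[of "k - r v" "r v" g] by (simp add: root_def)
    then show ?thesis using fixed reach[OF that(1) order.refl] unfolding root_def by simp
  qed
  have root_nxt: "root (nxt v) = root v" if v: "v \<in> ?V - N" for v
  proof -
    obtain k where k: "r v = Suc k" "r (nxt v) \<le> k" using *[OF v] by (cases "r v") auto
    have "root v = (g ^^ k) (nxt v)"
      using v k by (simp add: root_def funpow_Suc_right g_nxt del: funpow.simps)
    then show ?thesis using stable k(2) *[OF v] by simp
  qed
  have step: "v \<in> ?V \<and> root v = root u" if uv: "(u, v) \<in> ?A" for u v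
  proof -
    obtain w where w: "w \<in> ?V - N" "ends G (p w) = {u, v}"
      using uv unfolding adjacent_def by auto
    then have "(u = w \<and> v = nxt w) \<or> (v = w \<and> u = nxt w)"
      using *[OF w(1)] by (auto simp: doubleton_eq_iff)
    then show ?thesis using root_nxt[OF w(1)] w(1) *[OF w(1)] by auto
  qed
  have invariant: "root v = root u" if "(u, v) \<in> ?A\<^sup>*" for u v
    using that by induction (use step in auto)
  have to_root: "(v, root v) \<in> ?A\<^sup>*" if "v \<in> ?V" for v
    using that
  proof (induction "r v" arbitrary: v rule: less_induct)
    case less
    show ?case
    proof (cases "v \<in> N")
      case True
      then show ?thesis using fixed by (simp add: root_def)
    next
      case False
      then have v: "v \<in> ?V - N" using less.prems by simp
      then have "(v, nxt v) \<in> ?A" using *[OF v] unfolding adjacent_def by auto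
      moreover have "(nxt v, root v) \<in> ?A\<^sup>*" using less.hyps[of "nxt v"] *[OF v] root_nxt[OF v] by simp
      ultimately show ?thesis by (rule converse_rtrancl_into_rtrancl)
    qed
  qed
  obtain x where x: "x \<in> ?V" "C = {y \<in> ?V. (x, y) \<in> ?A\<^sup>*}"
    using assms(2) unfolding components_eq by auto
  show ?thesis
  proof (rule ex1I[of _ "root x"])
    show "root x \<in> C \<and> root x \<in> N"
      using x to_root reach[OF x(1) order.refl] unfolding root_def by auto
    fix y assume "y \<in> C \<and> y \<in> N"
    then show "y = root x" using x invariant[of x y] fixed[of y "r y"] unfolding root_def by simp
  qed
qed

lemma rooted_spanning_forest_parent_forest:
  assumes "parent_function G N p"
  shows "rooted_spanning_forest G N (parent_forest G N p)"
proof -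
  have "p v \<in> edges G \<and> ends G (p v) \<subseteq> verts G" if "v \<in> verts G - N" for v
    using parent_functionE[OF assms] that by (metis DiffD1 empty_subsetI insert_subset)
  then have "is_subgraph (parent_forest G N p) G" unfolding is_subgraph_def by auto
  then show ?thesis
    using parent_forest_acyclic[OF assms] parent_forest_unique_root[OF assms]
    unfolding rooted_spanning_forest_def by simp
qed

text \<open>By induction on the rank of \<open>p\<close>: the edge \<open>p v\<close> is
  \<open>q w\<close> with \<open>w = v\<close> or \<open>w = nxt v\<close>. In the latter case the
  induction hypothesis gives \<open>p w = q w = p v\<close>, and injectivity of \<open>p\<close>
  yields \<open>w = v\<close> all the same.\<close>

lemma parent_forest_inj_on: "inj_on (parent_forest G N) {p. parent_function G N p}"
proof (rule inj_onI, clarify)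
  fix p q
  assume p: "parent_function G N p" and q: "parent_function G N q"
    and eq: "parent_forest G N p = parent_forest G N q"
  have img: "p ` (verts G - N) = q ` (verts G - N)"
    using arg_cong[OF eq, of edges] by simp
  obtain r :: "'a \<Rightarrow> nat" and nxt where P: "\<And>v. v \<in> verts G - N \<Longrightarrow>
    p v \<in> edges G \<and> nxt v \<in> verts G \<and> ends G (p v) = {v, nxt v} \<and> r (nxt v) < r v"
    by (rule parent_functionE[OF p]) blast
  obtain r' :: "'a \<Rightarrow> nat" and nxt' where Q: "\<And>v. v \<in> verts G - N \<Longrightarrow>
    q v \<in> edges G \<and> nxt' v \<in> verts G \<and> ends G (q v) = {v, nxt' v} \<and> r' (nxt' v) < r' v"
    by (rule parent_functionE[OF q]) blast
  have "p v = q v" if "v \<in> verts G - N" for v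
    using that
  proof (induction "r v" arbitrary: v rule: less_induct)
    case less
    obtain w where w: "w \<in> verts G - N" "p v = q w" using img less.prems by blast
    then have "v = w \<or> w = nxt v" using P[OF less.prems] Q[OF w(1)] by (auto simp: doubleton_eq_iff)
    then show ?case
    proof
      assume "w = nxt v"
      then have "p w = q w" using less.hyps w(1) P[OF less.prems] by simp
      then have "v = w"
        using w less.prems parent_function_inj_on[OF p] by (metis inj_onD)
      then show ?thesis using w by simp
    qed (use w in simp)
  qed
  then show "p = q"
    using p q unfolding parent_function_def by (metis PiE_ext)
qed

section \<open>Simple paths and cycles closed by an extra edge\<close>

text \<open>Edges are prepended one at a time; if the new start vertex already lies on the path, the
  path is cut to begin there.\<close>

lemma adjacent_rtrancl_imp_path:
  assumes "(u, v) \<in> (adjacent H)\<^sup>*" and "v \<in> verts H"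
    and sub: "\<forall>e\<in>edges H. ends H e \<subseteq> verts H"
  shows "\<exists>vs es. vs \<noteq> [] \<and> hd vs = u \<and> last vs = v \<and> distinct vs \<and> set vs \<subseteq> verts H \<and>
    length vs = Suc (length es) \<and> set es \<subseteq> edges H \<and>
    (\<forall>i<length es. ends H (es ! i) = {vs ! i, vs ! Suc i})"
  using assms(1)
proof (induction rule: converse_rtrancl_induct)
  case base
  show ?case using assms(2) by (intro exI[of _ "[v]"] exI[of _ "[]"]) simp
next
  case (step u w)
  then obtain vs es where IH: "vs \<noteq> []" "hd vs = w" "last vs = v" "distinct vs" "set vs \<subseteq> verts H"
    "length vs = Suc (length es)" "set es \<subseteq> edges H"
    "\<And>i. i < length es \<Longrightarrow> ends H (es ! i) = {vs ! i, vs ! Suc i}" by blast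
  obtain e where e: "e \<in> edges H" "ends H e = {u, w}" using step.hyps(1) unfolding adjacent_def by auto
  show ?case
  proof (cases "u \<in> set vs")
    case False
    have "ends H ((e # es) ! i) = {(u # vs) ! i, (u # vs) ! Suc i}" if "i < length (e # es)" for i
      using that IH e by (cases i) (auto simp: hd_conv_nth)
    moreover have "u \<in> verts H" using e sub by auto
    ultimately show ?thesis
      using IH e False by (intro exI[of _ "u # vs"] exI[of _ "e # es"]) auto
  next
    case True
    then obtain j where j: "j < length vs" "vs ! j = u" by (metis in_set_conv_nth)
    show ?thesis
      using IH j set_drop_subset[of j vs] set_drop_subset[of j es]
      by (intro exI[of _ "drop j vs"] exI[of _ "drop j es"])
        (auto simp: hd_drop_conv_nth)
  qed
qed

lemma path_edges_distinct:
  assumes "distinct vs" and len: "length vs = Suc (length es)"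
    and ends: "\<And>i. i < length es \<Longrightarrow> ends H (es ! i) = {vs ! i, vs ! Suc i}"
  shows "distinct es"
proof -
  have "es ! i \<noteq> es ! j" if ij: "i < j" "j < length es" for i j
  proof
    assume "es ! i = es ! j"
    then have "{vs ! i, vs ! Suc i} = {vs ! j, vs ! Suc j}" using ends ij by (metis less_trans)
    then have "vs ! i = vs ! j \<or> vs ! i = vs ! Suc j" by blast
    then show False using assms(1) len ij by (auto simp: nth_eq_iff_index_eq)
  qed
  then show ?thesis unfolding distinct_conv_nth by (metis linorder_neqE_nat)
qed

text \<open>A simple path in \<open>H'\<close> from \<open>u\<close> to \<open>v\<close>, closed up
  by \<open>e\<close>, would be a cycle of \<open>H\<close>. For \<open>u = v\<close> the path has
  no edges and the cycle is the loop \<open>e\<close>.\<close>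

lemma acyclic_graph_extra_edge:
  assumes "acyclic_graph H" and sub: "\<forall>e\<in>edges H. ends H e \<subseteq> verts H"
    and "verts H' \<subseteq> verts H" and "edges H' \<subseteq> edges H" and "ends H' = ends H"
    and sub': "\<forall>e\<in>edges H'. ends H' e \<subseteq> verts H'"
    and e: "e \<in> edges H" "ends H e = {u, v}" and conn: "(u, v) \<in> (adjacent H')\<^sup>*" "v \<in> verts H'"
  shows "e \<in> edges H'"
proof (rule ccontr)
  assume e': "e \<notin> edges H'"
  obtain vs es where path: "vs \<noteq> []" "hd vs = u" "last vs = v" "distinct vs" "set vs \<subseteq> verts H'"
    "length vs = Suc (length es)" "set es \<subseteq> edges H'"
    "\<And>i. i < length es \<Longrightarrow> ends H' (es ! i) = {vs ! i, vs ! Suc i}"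
    using adjacent_rtrancl_imp_path[OF conn sub'] by blast
  have "distinct es" by (rule path_edges_distinct[OF path(4,6,8)])
  moreover have "ends H ((es @ [e]) ! i) = {vs ! i, vs ! (Suc i mod length vs)}"
    if "i < length vs" for i
  proof (cases "i < length es")
    case True
    then show ?thesis using path(6) path(8)[OF True] assms(5) by (simp add: nth_append)
  next
    case False
    then have i: "i = length es" using that path(6) by simp
    then have "vs ! i = v" "vs ! 0 = u"
      using path by (auto simp: last_conv_nth hd_conv_nth)
    then show ?thesis using i path(6) e(2) by (auto simp: nth_append)
  qed
  ultimately have "is_cycle H vs (es @ [e])"
    using path e(1) e' assms(3,4) unfolding is_cycle_def by auto
  then show False using assms(1) unfolding acyclic_graph_def by blast
qed

text \<open>The parent edge of a vertex is the first edge of a shortest path to a root.\<close>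

lemma rooted_spanning_forest_imp_parent_forest:
  assumes wf: "\<And>e. e \<in> edges G \<Longrightarrow> \<exists>u v. ends G e = {u, v}"
    and H: "rooted_spanning_forest G N H"
  shows "\<exists>p. parent_function G N p \<and> H = parent_forest G N p"
proof -
  let ?V = "verts G" and ?A = "adjacent H"
  have V: "verts H = ?V" and E: "edges H \<subseteq> edges G" and ends: "ends H = ends G"
    and sub: "\<forall>e\<in>edges H. ends G e \<subseteq> ?V" and acyc: "acyclic_graph H"
    and root: "\<And>C. C \<in> components H \<Longrightarrow> \<exists>!x. x \<in> C \<and> x \<in> N"
    using H unfolding rooted_spanning_forest_def is_subgraph_def by metis+
  have root_unique: "x = y" if "v \<in> ?V" "x \<in> N \<inter> ?V" "y \<in> N \<inter> ?V" "(v, x) \<in> ?A\<^sup>*" "(v, y) \<in> ?A\<^sup>*"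
    for v x y
  proof -
    have "{y \<in> ?V. (v, y) \<in> ?A\<^sup>*} \<in> components H" using that(1) V unfolding components_eq by auto
    then show ?thesis using root that by blast
  qed
  define r where "r v = (LEAST k. \<exists>x\<in>N. (v, x) \<in> ?A ^^ k)" for v
  have "\<exists>e. e \<in> edges H \<and> (\<exists>u\<in>?V. ends G e = {v, u} \<and> r u < r v)" if v: "v \<in> ?V - N" for v
  proof -
    have "{y \<in> ?V. (v, y) \<in> ?A\<^sup>*} \<in> components H" using v V unfolding components_eq by auto
    then have "\<exists>x\<in>N. (v, x) \<in> ?A\<^sup>*" using root by blast
    then have "\<exists>k. \<exists>x\<in>N. (v, x) \<in> ?A ^^ k" by (auto simp: rtrancl_power)
    then have "\<exists>x\<in>N. (v, x) \<in> ?A ^^ r v" unfolding r_def by (rule LeastI_ex)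
    then obtain x where x: "x \<in> N" "(v, x) \<in> ?A ^^ r v" by blast
    then obtain k where k: "r v = Suc k" using v by (cases "r v") auto
    then obtain u where u: "(v, u) \<in> ?A" "(u, x) \<in> ?A ^^ k" using x by (metis relpow_Suc_D2)
    then have "r u \<le> k" using x(1) unfolding r_def by (intro Least_le) blast
    moreover obtain e where "e \<in> edges H" "ends G e = {v, u}"
      using u(1) ends unfolding adjacent_def by auto
    moreover have "u \<in> ?V" using sub calculation by blast
    ultimately show ?thesis using k by (metis le_imp_less_Suc)
  qed
  then obtain q where q: "\<And>v. v \<in> ?V - N \<Longrightarrow>
      q v \<in> edges H \<and> (\<exists>u\<in>?V. ends G (q v) = {v, u} \<and> r u < r v)"
    by metis
  define p where "p = restrict q (?V - N)"
  let ?H = "parent_forest G N p"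
  have p: "parent_function G N p"
    using q E unfolding parent_function_def p_def by (auto intro!: exI[of _ r])
  have sub_p: "p ` (?V - N) \<subseteq> edges H" using q by (auto simp: p_def)
  then have adj: "(adjacent ?H)\<^sup>* \<subseteq> ?A\<^sup>*"
    unfolding adjacent_def by (intro rtrancl_mono) (auto simp: ends)
  have p_root: "\<exists>x\<in>N \<inter> ?V. (v, x) \<in> (adjacent ?H)\<^sup>*" if "v \<in> ?V" for v
    using parent_forest_unique_root[OF p, of "{y \<in> ?V. (v, y) \<in> (adjacent ?H)\<^sup>*}"] that
    unfolding components_eq by auto
  \<comment> \<open>The parent-forest roots of the two ends of \<open>e\<close> lie in one component
    of \<open>H\<close>, so they coincide. The ends are thus already joined in the parent forest,
    and acyclicity of \<open>H\<close> leaves no room for another edge.\<close>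
  have "e \<in> p ` (?V - N)" if e: "e \<in> edges H" for e
  proof -
    obtain u v where uv: "ends G e = {u, v}" using wf e E by blast
    then have V': "u \<in> ?V" "v \<in> ?V" using e sub by auto
    obtain x y where x: "x \<in> N \<inter> ?V" "(u, x) \<in> (adjacent ?H)\<^sup>*"
      and y: "y \<in> N \<inter> ?V" "(v, y) \<in> (adjacent ?H)\<^sup>*" using p_root V' by blast
    have "(u, v) \<in> ?A" using e uv ends unfolding adjacent_def by auto
    then have "(u, y) \<in> ?A\<^sup>*" using y adj by (meson converse_rtrancl_into_rtrancl subsetD)
    then have "x = y" using root_unique V'(1) x y adj by blast
    then have "(u, v) \<in> (adjacent ?H)\<^sup>*" using x y adjacent_rtrancl_sym by (metis rtrancl_trans)
    then have "e \<in> edges ?H"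
      using acyc sub ends V V' sub_p e uv
      by (intro acyclic_graph_extra_edge[of H ?H e u v]) (auto simp del: image_subset_iff)
    then show ?thesis by simp
  qed
  then have "edges H = p ` (?V - N)" using sub_p by blast
  then have "H = ?H" using V ends by (intro mgraph.equality) simp_all
  then show ?thesis using p by blast
qed

text \<open>Forests correspond bijectively to parent functions, and each forest edge is the parent
  edge of exactly one non-node. The assumption on \<open>ends\<close> enters in showing that every
  forest edge is a parent edge.\<close>

theorem forest_sum_parent_functions:
  assumes "\<And>e. e \<in> edges G \<Longrightarrow> \<exists>u v. ends G e = {u, v}"
  shows "forest_sum G N w = (\<Sum>p | parent_function G N p. \<Prod>v\<in>verts G - N. w (p v))"
proof -
  have "bij_betw (parent_forest G N) {p. parent_function G N p} {H. rooted_spanning_forest G N H}"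
    unfolding bij_betw_def
    using parent_forest_inj_on[of G N] rooted_spanning_forest_parent_forest[of G N]
      rooted_spanning_forest_imp_parent_forest[OF assms, where N = N]
    by (auto simp: image_iff)
  then have "forest_sum G N w =
      (\<Sum>p | parent_function G N p. \<Prod>e\<in>p ` (verts G - N). w e)"
    unfolding forest_sum_def by (simp add: sum.reindex_bij_betw[symmetric])
  also have "\<dots> = (\<Sum>p | parent_function G N p. \<Prod>v\<in>verts G - N. w (p v))"
    by (intro sum.cong refl) (simp add: prod.reindex parent_function_inj_on)
  finally show ?thesis .
qed

subsection \<open>Parent functions of the pendant cycle\<close>

text \<open>
  The walk from an internal vertex to its root leaves it by the pendant edge or along the cycle
  in one of the two directions. Here \<open>i < n\<close> stands for the vertex \<open>Inner (Suc i)\<close>.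
\<close>

datatype dir = To_Leaf | Forward | Backward

text \<open>Adding \<open>n - 1\<close> modulo \<open>n\<close> gives the cyclic predecessor without
  truncated subtraction at 0. The edge used backward from \<open>i\<close> carries the index of that
  predecessor.\<close>

fun dir_edge :: "nat \<Rightarrow> nat \<Rightarrow> dir \<Rightarrow> edge" where
  "dir_edge n i To_Leaf = Pend (Suc i)"
| "dir_edge n i Forward = Cyc (Suc i)"
| "dir_edge n i Backward = Cyc (Suc ((i + (n - 1)) mod n))"

fun dir_head :: "nat \<Rightarrow> nat \<Rightarrow> dir \<Rightarrow> vertex" where
  "dir_head n i To_Leaf = Leaf (Suc i)"
| "dir_head n i Forward = Inner (Suc (Suc i mod n))"
| "dir_head n i Backward = Inner (Suc ((i + (n - 1)) mod n))"

definition dir_parent :: "nat \<Rightarrow> dir list \<Rightarrow> vertex \<Rightarrow> edge" where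
  "dir_parent n ds = (\<lambda>v\<in>Inner ` {1..n}.
     case v of Inner k \<Rightarrow> dir_edge n (k - 1) (ds ! (k - 1)) | Leaf k \<Rightarrow> undefined)"

text \<open>The excluded pattern is a pair of cyclic neighbours pointing at each other along their
  common edge.\<close>

definition compatible :: "dir list \<Rightarrow> bool" where
  "compatible ds \<longleftrightarrow>
     (\<forall>i<length ds. \<not> (ds ! i = Forward \<and> ds ! (Suc i mod length ds) = Backward))"

text \<open>A constant \<open>Forward\<close> or \<open>Backward\<close> word describes a walk that
  circles forever and so admits no decreasing rank.\<close>

definition admissible :: "dir list \<Rightarrow> bool" where
  "admissible ds \<longleftrightarrow> compatible ds \<and>
     ds \<noteq> replicate (length ds) Forward \<and> ds \<noteq> replicate (length ds) Backward"

lemma verts_pendant_cycle: "verts (pendant_cycle n) = Inner ` {1..n} \<union> Leaf ` {1..n}"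
  by (simp add: pendant_cycle_def)

lemma pendant_cycle_simps [simp]:
  "edges (pendant_cycle n) = Cyc ` {1..n} \<union> Pend ` {1..n}"
  "ends (pendant_cycle n) = pendant_cycle_ends n"
  by (simp_all add: pendant_cycle_def)

lemma pendant_cycle_internal [simp]:
  "verts (pendant_cycle n) - pendant_cycle_nodes n = Inner ` {1..n}"
  by (auto simp: verts_pendant_cycle pendant_cycle_nodes_def)

lemma Inner_image: "Inner ` {1..n} = (\<lambda>i. Inner (Suc i)) ` {..<n}"
  by (simp add: image_Suc_lessThan flip: image_image[of Inner Suc])

lemma dir_parent_Inner [simp]: "i < n \<Longrightarrow> dir_parent n ds (Inner (Suc i)) = dir_edge n i (ds ! i)"
  by (auto simp: dir_parent_def)

lemma Suc_pred_mod: "(i::nat) < n \<Longrightarrow> Suc ((i + (n - 1)) mod n) mod n = i"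
  by (simp add: mod_Suc_eq)

lemma pred_Suc_mod: "(i::nat) < n \<Longrightarrow> (Suc i mod n + (n - 1)) mod n = i"
  by (cases "Suc i = n") simp_all

lemma ends_dir_edge:
  "i < n \<Longrightarrow> pendant_cycle_ends n (dir_edge n i d) = {Inner (Suc i), dir_head n i d}"
  using Suc_pred_mod[of i n] by (cases d) auto

lemma dir_edge_in_edges: "i < n \<Longrightarrow> dir_edge n i d \<in> Cyc ` {1..n} \<union> Pend ` {1..n}"
  by (cases d) (auto simp: Suc_le_eq)

lemma dir_head_in_verts: "i < n \<Longrightarrow> dir_head n i d \<in> verts (pendant_cycle n)"
  by (cases d) (auto simp: verts_pendant_cycle Suc_le_eq)

section \<open>From admissible words to parent functions\<close>

text \<open>The step \<open>c\<close> is 1 for forward motion and \<open>length ds - 1\<close>, that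
  is -1 modulo the length, for backward motion.\<close>

definition exit_time :: "dir list \<Rightarrow> dir \<Rightarrow> nat \<Rightarrow> nat \<Rightarrow> nat" where
  "exit_time ds d c i = (LEAST m. ds ! ((i + m * c) mod length ds) \<noteq> d)"

text \<open>Since \<open>ds ! i = d\<close>, the count from \<open>i\<close> is positive, and the
  same exit position is reached from \<open>i + c\<close> with one step fewer.\<close>

lemma exit_time_decreasing:
  assumes "i < length ds" and "ds ! i = d" and "\<exists>m. ds ! ((i + m * c) mod length ds) \<noteq> d"
  shows "exit_time ds d c ((i + c) mod length ds) < exit_time ds d c i"
proof -
  have k: "ds ! ((i + exit_time ds d c i * c) mod length ds) \<noteq> d"
    unfolding exit_time_def using assms(3) by (rule LeastI_ex)
  then obtain l where l: "exit_time ds d c i = Suc l"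
    using assms(1,2) by (cases "exit_time ds d c i") auto
  have "(i + Suc l * c) mod length ds = ((i + c) mod length ds + l * c) mod length ds"
    by (simp add: mod_add_left_eq add.assoc)
  then have "ds ! (((i + c) mod length ds + l * c) mod length ds) \<noteq> d" using k l by metis
  then show ?thesis unfolding l exit_time_def[of _ _ _ "(i + c) mod length ds"]
    by (intro le_imp_less_Suc Least_le)
qed

lemma ex_forward_orbit:
  fixes i j n :: nat
  assumes "i < n" "j < n"
  shows "\<exists>m. (i + m * 1) mod n = j"
  using assms by (intro exI[of _ "n + j - i"]) simp

lemma ex_backward_orbit:
  fixes i j n :: nat
  assumes "i < n" "j < n"
  shows "\<exists>m. (i + m * (n - 1)) mod n = j"
proof -
  \<comment> \<open>Here \<open>Suc t = n - j\<close>, so the number of steps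
    \<open>i + Suc t\<close> is congruent to \<open>i - j\<close>, and each step subtracts 1 modulo
    \<open>n\<close>.\<close>
  obtain t where t: "n = Suc (j + t)" using assms(2) less_iff_Suc_add by auto
  have "i + (i + Suc t) * (n - 1) = j + (i + t) * n" by (simp add: t algebra_simps)
  then show ?thesis using assms(2) by (intro exI[of _ "i + Suc t"]) simp
qed

lemma admissibleD:
  assumes "admissible ds"
  shows "i < length ds \<Longrightarrow> ds ! i = Forward \<Longrightarrow> ds ! (Suc i mod length ds) \<noteq> Backward"
    and "ds \<noteq> replicate (length ds) Forward" and "ds \<noteq> replicate (length ds) Backward"
  using assms by (simp_all add: admissible_def compatible_def)

lemma neq_replicate_nth:
  assumes "ds \<noteq> replicate (length ds) d"
  shows "\<exists>j<length ds. ds ! j \<noteq> d"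
  using assms nth_equalityI[of ds "replicate (length ds) d"] by auto

text \<open>In an admissible word a run of equal directions, followed in its own sense, can end only
  at \<open>To_Leaf\<close>; the rank counts the cycle edges on the way there.\<close>

definition dir_rank :: "dir list \<Rightarrow> nat \<Rightarrow> nat" where
  "dir_rank ds i = (case ds ! i of To_Leaf \<Rightarrow> 0
     | Forward \<Rightarrow> exit_time ds Forward 1 i
     | Backward \<Rightarrow> exit_time ds Backward (length ds - 1) i)"

text \<open>The next letter is \<open>Forward\<close>, with a smaller exit time, or
  \<open>To_Leaf\<close>, with rank 0; the strict inequality of exit times settles both
  cases.\<close>

lemma dir_rank_Forward:
  assumes "admissible ds" and i: "i < length ds" and d: "ds ! i = Forward"
  shows "dir_rank ds (Suc i mod length ds) < dir_rank ds i"
proof -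
  let ?j = "Suc i mod length ds"
  obtain k where k: "k < length ds" "ds ! k \<noteq> Forward"
    using neq_replicate_nth[OF admissibleD(2)[OF assms(1)]] by blast
  obtain m where m: "(i + m * 1) mod length ds = k" using ex_forward_orbit[OF i k(1)] ..
  then have "\<exists>m. ds ! ((i + m * 1) mod length ds) \<noteq> Forward" using k(2) by (intro exI[of _ m]) simp
  from exit_time_decreasing[OF i d this]
  have "exit_time ds Forward 1 ?j < exit_time ds Forward 1 i"
    by (simp only: Suc_eq_plus1)
  moreover have "ds ! ?j \<noteq> Backward"
    by (rule admissibleD(1)[OF assms])
  ultimately show ?thesis using d unfolding dir_rank_def by (cases "ds ! ?j") simp_all
qed

lemma dir_rank_Backward:
  assumes "admissible ds" and i: "i < length ds" and d: "ds ! i = Backward"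
  shows "dir_rank ds ((i + (length ds - 1)) mod length ds) < dir_rank ds i"
proof -
  define j where "j = (i + (length ds - 1)) mod length ds"
  obtain k where k: "k < length ds" "ds ! k \<noteq> Backward"
    using neq_replicate_nth[OF admissibleD(3)[OF assms(1)]] by blast
  obtain m where m: "(i + m * (length ds - 1)) mod length ds = k"
    using ex_backward_orbit[OF i k(1)] ..
  then have "\<exists>m. ds ! ((i + m * (length ds - 1)) mod length ds) \<noteq> Backward"
    using k(2) by (intro exI[of _ m]) simp
  from exit_time_decreasing[OF i d this]
  have "exit_time ds Backward (length ds - 1) j < exit_time ds Backward (length ds - 1) i"
    unfolding j_def .
  \<comment> \<open>Compatibility is applied at the predecessor \<open>j\<close>, whose cyclic
    successor is \<open>i\<close>.\<close>
  moreover have "j < length ds" using i unfolding j_def by (intro mod_less_divisor) linarith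
  then have "ds ! j \<noteq> Forward"
    using admissibleD(1)[OF assms(1), of j] d Suc_pred_mod[OF i] unfolding j_def[symmetric] by auto
  ultimately show ?thesis
    using d unfolding j_def[symmetric] dir_rank_def by (cases "ds ! j") simp_all
qed

lemma parent_function_dir_parent:
  assumes "admissible ds" "length ds = n"
  shows "parent_function (pendant_cycle n) (pendant_cycle_nodes n) (dir_parent n ds)"
proof -
  \<comment> \<open>Ranks on the cycle are raised by one so that leaves, at rank 0, lie below
    vertices with \<open>dir_rank\<close> 0.\<close>
  define r where "r v = (case v of Inner k \<Rightarrow> Suc (dir_rank ds (k - 1)) | Leaf k \<Rightarrow> 0)" for v
  have rank: "r (dir_head n i (ds ! i)) < r (Inner (Suc i))" if "i < n" for i
    using that dir_rank_Forward[OF assms(1), of i] dir_rank_Backward[OF assms(1), of i]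
    unfolding assms(2) by (cases "ds ! i") (simp_all add: r_def)
  have "dir_parent n ds v \<in> edges (pendant_cycle n) \<and> (\<exists>u\<in>verts (pendant_cycle n).
      pendant_cycle_ends n (dir_parent n ds v) = {v, u} \<and> r u < r v)" if v: "v \<in> Inner ` {1..n}" for v
  proof -
    obtain i where i: "i < n" "v = Inner (Suc i)" using v unfolding Inner_image by auto
    show ?thesis
      using dir_edge_in_edges[OF i(1), of "ds ! i"] dir_head_in_verts[OF i(1), of "ds ! i"]
        ends_dir_edge[OF i(1), of "ds ! i"] rank[OF i(1)]
      unfolding i(2) dir_parent_Inner[OF i(1)] pendant_cycle_simps by blast
  qed
  moreover have "dir_parent n ds v = undefined" if "v \<notin> Inner ` {1..n}" for v
    using that by (simp add: dir_parent_def)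
  ultimately show ?thesis
    unfolding parent_function_def pendant_cycle_internal pendant_cycle_simps(2) PiE_iff extensional_def
    by blast
qed

section \<open>From parent functions to admissible words\<close>

lemma ends_eq_imp_dir:
  assumes "e \<in> Cyc ` {1..n} \<union> Pend ` {1..n}" and "pendant_cycle_ends n e = {Inner (Suc i), u}"
    and i: "i < n"
  shows "\<exists>d. e = dir_edge n i d \<and> u = dir_head n i d"
proof -
  have "\<exists>d. e = dir_edge n i d"
  proof (cases e)
    case (Pend k)
    then have "e = dir_edge n i To_Leaf" using assms(2) by (auto simp: doubleton_eq_iff)
    then show ?thesis ..
  next
    case (Cyc k)
    then have k: "1 \<le> k" "k \<le> n" using assms(1) by auto
    have "k = Suc i \<or> k mod n = i" using assms(2) Cyc by (auto simp: doubleton_eq_iff)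
    then show ?thesis
    proof
      assume "k = Suc i"
      then have "e = dir_edge n i Forward" using Cyc by simp
      then show ?thesis ..
    next
      \<comment> \<open>Adding \<open>n - 1\<close> turns the residue of \<open>k\<close> into that
        of \<open>k - 1\<close>, which is \<open>k - 1\<close> itself because
        \<open>1 \<le> k \<le> n\<close>.\<close>
      assume "k mod n = i"
      then have "(i + (n - 1)) mod n = (k + (n - 1)) mod n" by (metis mod_add_left_eq)
      also have "k + (n - 1) = k - 1 + n" using k by simp
      also have "(k - 1 + n) mod n = k - 1" using k by (subst mod_add_self2) simp
      finally have "Suc ((i + (n - 1)) mod n) = k" using k by simp
      then have "e = dir_edge n i Backward" using Cyc by simp
      then show ?thesis ..
    qed
  qed
  then obtain d where d: "e = dir_edge n i d" ..
  then have "u = dir_head n i d" using assms(2) ends_dir_edge[OF i, of d] by (auto simp: doubleton_eq_iff)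
  then show ?thesis using d by blast
qed

lemma parent_function_imp_dir_parent:
  assumes p: "parent_function (pendant_cycle n) (pendant_cycle_nodes n) p" and n: "n \<ge> 1"
  shows "\<exists>ds. length ds = n \<and> admissible ds \<and> p = dir_parent n ds"
proof -
  obtain r :: "vertex \<Rightarrow> nat" and nxt where
    "\<And>v. v \<in> verts (pendant_cycle n) - pendant_cycle_nodes n \<Longrightarrow>
      p v \<in> edges (pendant_cycle n) \<and> nxt v \<in> verts (pendant_cycle n) \<and>
      ends (pendant_cycle n) (p v) = {v, nxt v} \<and> r (nxt v) < r v"
    by (rule parent_functionE[OF p]) blast
  then have *: "p v \<in> Cyc ` {1..n} \<union> Pend ` {1..n} \<and>
      pendant_cycle_ends n (p v) = {v, nxt v} \<and> r (nxt v) < r v" if "v \<in> Inner ` {1..n}" for v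
    using that unfolding pendant_cycle_internal pendant_cycle_simps by blast
  have "\<exists>d. p (Inner (Suc i)) = dir_edge n i d \<and> r (dir_head n i d) < r (Inner (Suc i))"
    if i: "i < n" for i
  proof -
    have v: "Inner (Suc i) \<in> Inner ` {1..n}" using i by simp
    obtain d where "p (Inner (Suc i)) = dir_edge n i d" "nxt (Inner (Suc i)) = dir_head n i d"
      using ends_eq_imp_dir[OF _ _ i] *[OF v] by blast
    then show ?thesis using *[OF v] by auto
  qed
  then obtain d where d: "\<And>i. i < n \<Longrightarrow>
    p (Inner (Suc i)) = dir_edge n i (d i) \<and> r (dir_head n i (d i)) < r (Inner (Suc i))"
    by metis
  define ds where "ds = map d [0..<n]"
  have len: "length ds = n" by (simp add: ds_def)
  define \<rho> where "\<rho> i = r (Inner (Suc i))" for i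
  have fwd: "\<rho> (Suc i mod n) < \<rho> i" if "i < n" "ds ! i = Forward" for i
    using d[of i] that by (simp add: ds_def \<rho>_def)
  have bwd: "\<rho> ((i + (n - 1)) mod n) < \<rho> i" if "i < n" "ds ! i = Backward" for i
    using d[of i] that by (simp add: ds_def \<rho>_def)
  \<comment> \<open>A vertex of minimal rank on the cycle cannot move along the cycle, which
    excludes both constant words.\<close>
  have "Min (\<rho> ` {..<n}) \<in> \<rho> ` {..<n}" using n by (intro Min_in) (auto simp: lessThan_empty_iff)
  then obtain m where m: "m < n" "Min (\<rho> ` {..<n}) = \<rho> m" by auto
  have min: "\<rho> m \<le> \<rho> (i mod n)" for i
    using n m(2)[symmetric] by simp
  have "compatible ds"
    unfolding compatible_def len
  proof (intro allI impI notI, elim conjE)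
    fix i assume i: "i < n" "ds ! i = Forward" "ds ! (Suc i mod n) = Backward"
    then have "\<rho> i < \<rho> (Suc i mod n)" using bwd[of "Suc i mod n"] pred_Suc_mod[OF i(1)] by simp
    then show False using fwd[OF i(1,2)] by simp
  qed
  moreover have "ds \<noteq> replicate n Forward"
    using fwd[OF m(1)] m(1) min[of "Suc m"] by auto
  moreover have "ds \<noteq> replicate n Backward"
    using bwd[OF m(1)] m(1) min[of "m + (n - 1)"] by auto
  ultimately have "admissible ds" by (simp add: admissible_def len)
  moreover have "p = dir_parent n ds"
  proof (rule PiE_ext[of _ "Inner ` {1..n}" "\<lambda>_. Cyc ` {1..n} \<union> Pend ` {1..n}"])
    show "p \<in> Inner ` {1..n} \<rightarrow>\<^sub>E Cyc ` {1..n} \<union> Pend ` {1..n}"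
      using p unfolding parent_function_def by simp
    show "dir_parent n ds \<in> Inner ` {1..n} \<rightarrow>\<^sub>E Cyc ` {1..n} \<union> Pend ` {1..n}"
      using parent_function_dir_parent[OF calculation len] unfolding parent_function_def by simp
    show "p v = dir_parent n ds v" if "v \<in> Inner ` {1..n}" for v
      using that d unfolding Inner_image by (auto simp: ds_def)
  qed
  ultimately show ?thesis using len by blast
qed

text \<open>From length 2 on, the three directions at a vertex use distinct edges. At length 1
  \<open>Forward\<close> and \<open>Backward\<close> share the loop, but \<open>[To_Leaf]\<close> is
  the only admissible word.\<close>

lemma dir_parent_inj_on: "inj_on (dir_parent n) {ds. length ds = n \<and> admissible ds}"
proof (rule inj_onI, clarify)
  fix ds ds'
  assume ds: "admissible ds" "n = length ds" and ds': "admissible ds'" "length ds' = length ds"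
    and eq: "dir_parent (length ds) ds = dir_parent (length ds) ds'"
  show "ds = ds'"
  proof (rule nth_equalityI)
    fix i assume i: "i < length ds"
    have e: "dir_edge (length ds) i (ds ! i) = dir_edge (length ds) i (ds' ! i)"
      using fun_cong[OF eq, of "Inner (Suc i)"] i by simp
    show "ds ! i = ds' ! i"
    proof (cases "length ds = 1")
      case True
      have "xs ! 0 = To_Leaf" if "admissible xs" "length xs = 1" for xs
        using that by (cases "xs ! 0") (auto simp: admissible_def length_Suc_conv)
      then show ?thesis using ds ds' True i by simp
    next
      case False
      then have "Suc i mod length ds \<noteq> i" using i by (cases "Suc i = length ds") auto
      then have "(i + (length ds - 1)) mod length ds \<noteq> i" using Suc_pred_mod[OF i] by metis
      then show ?thesis using e by (cases "ds ! i"; cases "ds' ! i") auto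
    qed
  qed (use ds' in simp)
qed

fun dir_weight :: "'a \<Rightarrow> 'a \<Rightarrow> dir \<Rightarrow> 'a" where
  "dir_weight a b To_Leaf = a"
| "dir_weight a b Forward = b"
| "dir_weight a b Backward = b"

lemma pendant_cycle_weight_dir_edge [simp]:
  "pendant_cycle_weight a b (dir_edge n i d) = dir_weight a b d"
  by (cases d) simp_all

theorem F_eq_sum_admissible:
  assumes "n \<ge> 1"
  shows "F n a b = (\<Sum>ds | length ds = n \<and> admissible ds. \<Prod>i<n. dir_weight a b (ds ! i))"
proof -
  let ?G = "pendant_cycle n" and ?N = "pendant_cycle_nodes n"
  have bij: "bij_betw (dir_parent n) {ds. length ds = n \<and> admissible ds} {p. parent_function ?G ?N p}"
    unfolding bij_betw_def using dir_parent_inj_on parent_function_dir_parent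
      parent_function_imp_dir_parent[OF _ assms] by (auto simp: image_iff)
  have "\<exists>u v. ends ?G e = {u, v}" for e by (cases e) auto
  then have "F n a b = (\<Sum>p | parent_function ?G ?N p. \<Prod>v\<in>Inner ` {1..n}. pendant_cycle_weight a b (p v))"
    unfolding F_def by (subst forest_sum_parent_functions) simp_all
  also have "\<dots> = (\<Sum>ds | length ds = n \<and> admissible ds.
      \<Prod>v\<in>Inner ` {1..n}. pendant_cycle_weight a b (dir_parent n ds v))"
    by (rule sum.reindex_bij_betw[OF bij, symmetric])
  also have "\<dots> = (\<Sum>ds | length ds = n \<and> admissible ds. \<Prod>i<n. dir_weight a b (ds ! i))"
    unfolding Inner_image by (simp add: prod.reindex inj_on_def)
  finally show ?thesis .
qed

subsection \<open>The transfer matrix and Chebyshev polynomials\<close>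

lemma UNIV_dir: "(UNIV :: dir set) = {To_Leaf, Forward, Backward}"
  using dir.exhaust by auto

instance dir :: finite
  by standard (simp add: UNIV_dir)

text \<open>This is the \<open>(x, z)\<close> entry of the \<open>n\<close>-th power of the matrix
  \<open>M\<close>.\<close>

fun walk_sum :: "('s \<Rightarrow> 's \<Rightarrow> 'a::comm_ring_1) \<Rightarrow> nat \<Rightarrow> 's \<Rightarrow> 's \<Rightarrow> 'a" where
  "walk_sum M 0 x z = (if x = z then 1 else 0)"
| "walk_sum M (Suc n) x z = (\<Sum>y\<in>UNIV. M x y * walk_sum M n y z)"

lemma sum_lists_Suc:
  "(\<Sum>xs | length xs = Suc n. f xs) = (\<Sum>x\<in>UNIV. \<Sum>xs | length xs = n. f (x # xs))"
proof -
  have eq: "{xs. length xs = Suc n} = (\<lambda>(x, xs). x # xs) ` (UNIV \<times> {xs. length xs = n})"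
    by (auto simp: length_Suc_conv)
  have inj: "inj_on (\<lambda>(x, xs). x # xs) (UNIV \<times> {xs. length xs = n})"
    by (auto simp: inj_on_def)
  show ?thesis
    unfolding eq sum.reindex[OF inj] by (simp add: sum.cartesian_product case_prod_unfold)
qed

text \<open>The list \<open>xs\<close> holds the intermediate states of a walk from \<open>x\<close>
  to \<open>z\<close>; pairing \<open>x # xs\<close> with \<open>xs @ [z]\<close> enumerates its
  steps.\<close>

lemma walk_sum_eq_sum_lists:
  fixes M :: "'s::finite \<Rightarrow> 's \<Rightarrow> 'a::comm_ring_1"
  shows "(\<Sum>xs | length xs = n. \<Prod>i<Suc n. M ((x # xs) ! i) ((xs @ [z]) ! i)) = walk_sum M (Suc n) x z"
proof (induction n arbitrary: x)
  case 0
  have "walk_sum M (Suc 0) x z = (\<Sum>y\<in>UNIV. if y = z then M x y else 0)"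
    unfolding walk_sum.simps by (intro sum.cong refl) simp
  then show ?case by simp
next
  case (Suc n)
  have "(\<Sum>xs | length xs = Suc n. \<Prod>i<Suc (Suc n). M ((x # xs) ! i) ((xs @ [z]) ! i)) =
      (\<Sum>y\<in>UNIV. \<Sum>xs | length xs = n.
        M x y * (\<Prod>i<Suc n. M ((y # xs) ! i) ((xs @ [z]) ! i)))"
    by (simp only: sum_lists_Suc prod.lessThan_Suc_shift) simp
  also have "\<dots> = walk_sum M (Suc (Suc n)) x z"
    by (simp only: Suc.IH walk_sum.simps(2)[of M "Suc n"] flip: sum_distrib_left)
  finally show ?case .
qed

lemma trace_eq_sum_cyclic_lists:
  fixes M :: "'s::finite \<Rightarrow> 's \<Rightarrow> 'a::comm_ring_1"
  assumes "n \<ge> 1"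
  shows "(\<Sum>xs | length xs = n. \<Prod>i<n. M (xs ! i) (xs ! (Suc i mod n))) =
    (\<Sum>x\<in>UNIV. walk_sum M n x x)"
proof -
  obtain m where m: "n = Suc m" using assms by (cases n) auto
  \<comment> \<open>A cyclic word with first letter \<open>x\<close> is a closed walk: wrapping
    around amounts to appending \<open>x\<close>.\<close>
  have "(xs @ [x]) ! i = (x # xs) ! (Suc i mod n)" if "length xs = m" "i < n" for x :: 's and xs i
    using that m by (cases "i = m") (auto simp: nth_append)
  then show ?thesis
    unfolding m sum_lists_Suc walk_sum_eq_sum_lists[symmetric]
    by (intro sum.cong prod.cong refl) (simp add: m)
qed

text \<open>Each step carries the weight of its source letter, and the zero entry removes the words
  that are not compatible.\<close>

definition transfer :: "'a::comm_ring_1 \<Rightarrow> 'a \<Rightarrow> dir \<Rightarrow> dir \<Rightarrow> 'a" where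
  "transfer a b d e = (if d = Forward \<and> e = Backward then 0 else dir_weight a b d)"

lemma prod_transfer:
  assumes "length ds = n"
  shows "(\<Prod>i<n. transfer a b (ds ! i) (ds ! (Suc i mod n))) =
    (if compatible ds then \<Prod>i<n. dir_weight a b (ds ! i) else 0)"
proof (cases "compatible ds")
  case True
  then show ?thesis using assms
    by (auto simp: compatible_def transfer_def intro!: prod.cong)
next
  case False
  then show ?thesis using assms by (auto simp: compatible_def transfer_def intro!: prod_zero)
qed

lemma finite_lists_length: "finite {xs :: 's::finite list. length xs = n}"
  using finite_lists_length_eq[of "UNIV :: 's set" n] by simp

lemma compatible_replicate: "d = Forward \<or> d = Backward \<Longrightarrow> compatible (replicate n d)"
  by (auto simp: compatible_def)

lemma F_eq_trace:
  assumes n: "n \<ge> 1"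
  shows "F n a b = (\<Sum>d\<in>UNIV. walk_sum (transfer a b) n d d) - 2 * b ^ n"
proof -
  let ?W = "\<lambda>ds. \<Prod>i<n. dir_weight a b (ds ! i)"
  let ?F = "replicate n Forward" and ?B = "replicate n Backward"
  \<comment> \<open>Only the two constant cycle words are compatible but not admissible; each
    contributes \<open>b ^ n\<close>, whence the correction \<open>2 * b ^ n\<close>.\<close>
  have split: "{ds. length ds = n \<and> compatible ds} =
      insert ?F (insert ?B {ds. length ds = n \<and> admissible ds})"
    by (auto simp: admissible_def compatible_replicate)
  have fin: "finite {ds. length ds = n \<and> admissible ds}"
    by (rule finite_subset[OF _ finite_lists_length[of n]]) auto
  have neq: "?F \<noteq> ?B" using n by (auto simp: replicate_eq_replicate)
  have "(\<Sum>d\<in>UNIV. walk_sum (transfer a b) n d d) =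
      (\<Sum>ds | length ds = n. if compatible ds then ?W ds else 0)"
    unfolding trace_eq_sum_cyclic_lists[OF n, symmetric]
    by (intro sum.cong refl) (simp add: prod_transfer)
  also have "\<dots> = (\<Sum>ds | length ds = n \<and> compatible ds. ?W ds)"
    by (subst sum.inter_filter[symmetric]) (simp_all add: finite_lists_length)
  also have "\<dots> = ?W ?F + (?W ?B + F n a b)"
    unfolding split F_eq_sum_admissible[OF n]
    using fin neq by (subst sum.insert; simp add: admissible_def)+
  also have "?W ?F = b ^ n" by simp
  also have "?W ?B = b ^ n" by simp
  finally show ?thesis by (simp add: algebra_simps)
qed

text \<open>The rows of \<open>To_Leaf\<close> and \<open>Backward\<close> are both multiples of the
  all-ones row, which accounts for the eigenvalue 0.\<close>

lemma walk_sum_transfer: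
  "walk_sum (transfer a b) (Suc n) To_Leaf z = a * (walk_sum (transfer a b) n To_Leaf z +
     walk_sum (transfer a b) n Forward z + walk_sum (transfer a b) n Backward z)"
  "walk_sum (transfer a b) (Suc n) Forward z = b * (walk_sum (transfer a b) n To_Leaf z +
     walk_sum (transfer a b) n Forward z)"
  "walk_sum (transfer a b) (Suc n) Backward z = b * (walk_sum (transfer a b) n To_Leaf z +
     walk_sum (transfer a b) n Forward z + walk_sum (transfer a b) n Backward z)"
  by (simp_all add: UNIV_dir transfer_def algebra_simps)

text \<open>The transfer matrix has characteristic polynomial \<open>x (x\<^sup>2 - (a + 2 b) x + b\<^sup>2)\<close>.\<close>

lemma walk_sum_transfer_recurrence:
  "walk_sum (transfer a b) (Suc (Suc (Suc n))) d z =
     (a + 2 * b) * walk_sum (transfer a b) (Suc (Suc n)) d z -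
     b\<^sup>2 * walk_sum (transfer a b) (Suc n) d z"
  by (cases d) (simp_all only: walk_sum_transfer, simp_all add: algebra_simps power2_eq_square)

section \<open>The Chebyshev recurrence over an arbitrary commutative ring\<close>

lemma map_poly_of_int_eqs:
  fixes p q :: "int poly"
  shows "poly (map_poly of_int (p - q)) (x :: 'a::comm_ring_1) =
      poly (map_poly of_int p) x - poly (map_poly of_int q) x"
    and "poly (map_poly of_int (p * q)) x = poly (map_poly of_int p) x * poly (map_poly of_int q) x"
proof -
  have "map_poly (of_int :: int \<Rightarrow> 'a) (p - q) = map_poly of_int p - map_poly of_int q"
    by (rule poly_eqI) (simp add: coeff_map_poly)
  then show "poly (map_poly of_int (p - q)) x =
      poly (map_poly of_int p) x - poly (map_poly of_int q) x" by simp
  have "map_poly (of_int :: int \<Rightarrow> 'a) (p * q) = map_poly of_int p * map_poly of_int q"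
    by (rule poly_eqI) (simp add: coeff_map_poly coeff_mult)
  then show "poly (map_poly of_int (p * q)) x =
      poly (map_poly of_int p) x * poly (map_poly of_int q) x" by simp
qed

lemma chebyshev_T_eqI:
  assumes "\<And>\<theta>::real. poly (map_poly of_int p) (cos \<theta>) = cos (real n * \<theta>)"
  shows "chebyshev_T n = p"
  using chebyshev_T_ex1[of n] chebyshev_T_cos[of n] assms by blast

lemma chebyshev_T_0: "chebyshev_T 0 = 1"
  by (rule chebyshev_T_eqI) simp

lemma chebyshev_T_1: "chebyshev_T (Suc 0) = [:0, 1:]"
  by (rule chebyshev_T_eqI) (simp add: map_poly_pCons)

text \<open>It suffices to compare values at \<open>cos \<theta>\<close>, where the recurrence is
  the sum of the addition formulas for \<open>(n + 1) \<theta> \<pm> \<theta>\<close>.\<close>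

lemma chebyshev_T_Suc_Suc:
  "chebyshev_T (Suc (Suc n)) = [:0, 2:] * chebyshev_T (Suc n) - chebyshev_T n"
proof (rule chebyshev_T_eqI)
  fix \<theta> :: real
  have "cos (real (Suc (Suc n)) * \<theta>) + cos (real n * \<theta>) = 2 * cos \<theta> * cos (real (Suc n) * \<theta>)"
    using cos_add[of "real (Suc n) * \<theta>" \<theta>] cos_diff[of "real (Suc n) * \<theta>" \<theta>]
    by (simp add: algebra_simps)
  then show "poly (map_poly of_int ([:0, 2:] * chebyshev_T (Suc n) - chebyshev_T n)) (cos \<theta>) =
      cos (real (Suc (Suc n)) * \<theta>)"
    by (simp only: map_poly_of_int_eqs chebyshev_T_cos) (simp add: map_poly_pCons algebra_simps)
qed

lemma poly_chebyshev_T: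
  fixes x :: "'a::comm_ring_1"
  shows "poly (map_poly of_int (chebyshev_T 0)) x = 1"
    and "poly (map_poly of_int (chebyshev_T (Suc 0))) x = x"
    and "poly (map_poly of_int (chebyshev_T (Suc (Suc n)))) x =
      2 * x * poly (map_poly of_int (chebyshev_T (Suc n))) x - poly (map_poly of_int (chebyshev_T n)) x"
  by (simp_all only: chebyshev_T_0 chebyshev_T_1 chebyshev_T_Suc_Suc map_poly_of_int_eqs)
    (simp_all add: map_poly_pCons)

text \<open>Scaling the Chebyshev recurrence by powers of \<open>b\<close> turns it into the
  recurrence of the traces. Writing the argument as a solution \<open>x\<close> of
  \<open>2 * b * x = a + 2 * b\<close> avoids division.\<close>

lemma trace_transfer:
  fixes a b x :: "'a::comm_ring_1"
  assumes x: "2 * b * x = a + 2 * b"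
  shows "(\<Sum>d\<in>UNIV. walk_sum (transfer a b) (Suc n) d d) =
    2 * b ^ Suc n * poly (map_poly of_int (chebyshev_T (Suc n))) x"
proof (induction n rule: less_induct)
  case (less n)
  \<comment> \<open>The base cases are the first and second powers: at power 0 the trace is 3, while
    \<open>2 * b ^ 0\<close> times the value of \<open>chebyshev_T 0\<close> is 2.\<close>
  consider "n = 0" | "n = Suc 0" | m where "n = Suc (Suc m)"
    by (metis not0_implies_Suc)
  then show ?case
  proof cases
    case 1
    have "(\<Sum>d\<in>UNIV. walk_sum (transfer a b) (Suc 0) d d) = a + 2 * b"
      unfolding UNIV_dir by (simp add: walk_sum_transfer del: walk_sum.simps(2))
    then show ?thesis using 1 x by (simp add: poly_chebyshev_T)
  next
    case 2
    have "(\<Sum>d\<in>UNIV. walk_sum (transfer a b) (Suc (Suc 0)) d d) = (a + 2 * b)\<^sup>2 - 2 * b\<^sup>2"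
      unfolding UNIV_dir
      by (simp add: walk_sum_transfer algebra_simps power2_eq_square del: walk_sum.simps(2))
    then show ?thesis
      using 2 unfolding x[symmetric] by (simp add: poly_chebyshev_T algebra_simps power2_eq_square)
  next
    case (3 m)
    let ?t = "\<lambda>n. \<Sum>d\<in>UNIV. walk_sum (transfer a b) n d d"
    let ?T = "\<lambda>n. poly (map_poly of_int (chebyshev_T n)) x"
    have "?t (Suc n) = 2 * b * x * ?t (Suc (Suc m)) - b\<^sup>2 * ?t (Suc m)"
      unfolding 3 walk_sum_transfer_recurrence x by (simp only: sum_subtractf sum_distrib_left)
    also have "\<dots> = 2 * b * x * (2 * b ^ Suc (Suc m) * ?T (Suc (Suc m))) -
        b\<^sup>2 * (2 * b ^ Suc m * ?T (Suc m))"
      using less.IH[of "Suc m"] less.IH[of m] 3 by simp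
    also have "\<dots> = 2 * b ^ Suc n * ?T (Suc n)"
      unfolding 3 poly_chebyshev_T(3)[of "Suc m"] by (simp add: algebra_simps power2_eq_square)
    finally show ?thesis .
  qed
qed

theorem theorem3p5:
  fixes n :: nat and a b :: "'r::idom poly poly fract"
  assumes "n \<ge> 1" and "(2::'r) \<noteq> 0"
    and "a = indet_a" and "b = indet_b"
  shows "F n a b =
    2 * b ^ n * (poly (map_poly of_int (chebyshev_T n)) (a / (2 * b) + 1) - 1)"
proof -
  \<comment> \<open>Since 2 is nonzero in the coefficient ring, \<open>2 * b\<close> is invertible,
    so \<open>a / (2 * b) + 1\<close> solves the equation required by
    \<open>trace_transfer\<close>.\<close>
  have "2 * b = to_fract [:[:0, 2:]:]"
    unfolding assms(4) indet_b_def mult_2 by (simp flip: to_fract_add)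
  then have "2 * b \<noteq> 0" using assms(2) by simp
  then have "2 * b * (a / (2 * b) + 1) = a + 2 * b" by (simp add: algebra_simps)
  from trace_transfer[OF this, of "n - 1"] show ?thesis
    using assms(1) F_eq_trace[OF assms(1), of a b] by (simp add: algebra_simps)
qed

end
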